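(* For all integers $n\ge 2$ and $k\ge 1$, the Ward-Lah numbers $W(n,k)$ satisfy $$W(n,k)=2(2n-1)\,W(n-1,k-1)-n(n-2)\,W(n-2,k)-(-2n+1)\,W(n-1,k).$$
   Context: Partition transformation: for integers $n,k\ge 0$ and a sequence $a_1,a_2,\dots$, $$P_n^k(a_1,a_2,\dots)=\sum_{q}(-1)^{q_0}\prod_{j=0}^{\ell(q)-1}\binom{q_j}{q_{j+1}}a_{j+1}^{q_j},$$ where the sum is over integer partitions $q=(q_0\ge q_1\ge\dots)$ of $n=q_0+q_1+\cdots$ with $q_0=k$; $\ell(q)$ is the length of $q$ (number of positive parts), so $q_{\ell(q)-1}>0$ and $q_{\ell(q)}=0$. Falling factorial: $x^{\underline{n}}=\prod_{i=0}^{n-1}(x-i)$. Ward-Lah numbers: for integers $n\ge k\ge 0$, $W(n,k)=(-1)^k (n+k)^{\underline{n}}\,P_n^k(1,1,\dots)$ (all $a_i=1$), with $W(0,0)=1$, $W(n,0)=0$ for $n\ge 1$, $W(0,k)=0$ for $k\ge 1$, and $W(n,k)=0$ for $k>n$. *)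

theory Defs
  imports Main
begin

text \<open>A partition \<open>q\<^sub>0 \<ge> q\<^sub>1 \<ge> \<dots>\<close> is encoded as the infinite sequence of its parts padded with
  zeros, so that \<open>q (plen q) = 0\<close>, and \<open>q 0 = 0\<close> for the empty partition.\<close>

definition is_partition :: "nat \<Rightarrow> (nat \<Rightarrow> nat) \<Rightarrow> bool" where
  "is_partition n q \<longleftrightarrow> antimono q \<and> finite {j. q j > 0} \<and> (\<Sum>j | q j > 0. q j) = n"

definition plen :: "(nat \<Rightarrow> nat) \<Rightarrow> nat" where
  "plen q = card {j. q j > 0}"

text \<open>The sequence \<open>a\<close> is indexed from 1; the value \<open>a 0\<close> is never used.\<close>

definition partition_transform :: "nat \<Rightarrow> nat \<Rightarrow> (nat \<Rightarrow> 'a::comm_ring_1) \<Rightarrow> 'a" where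
  "partition_transform n k a =
     (\<Sum>q | is_partition n q \<and> q 0 = k.
        (- 1) ^ q 0 * (\<Prod>j<plen q. of_nat (q j choose q (j + 1)) * a (j + 1) ^ q j))"

definition falling_fact :: "'a::comm_ring_1 \<Rightarrow> nat \<Rightarrow> 'a" where
  "falling_fact x n = (\<Prod>i<n. x - of_nat i)"

definition ward_lah :: "nat \<Rightarrow> nat \<Rightarrow> int" where
  "ward_lah n k =
     (if k \<le> n then (- 1) ^ k * falling_fact (int n + int k) n * partition_transform n k (\<lambda>_. 1)
      else 0)"

lemma plen_support:
  assumes "is_partition n q"
  shows "{j. q j > 0} = {..<plen q}"
proof -
  let ?S = "{j. q j > 0}"
  have fin: "finite ?S" and anti: "antimono q"
    using assms by (auto simp: is_partition_def)
  have down: "i \<in> ?S" if "j \<in> ?S" "i \<le> j" for i j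
    using that antimonoD[OF anti, of i j] by auto
  have "\<exists>m. ?S = {..<m}"
  proof (cases "?S = {}")
    case False
    have "?S = {..<Suc (Max ?S)}"
    proof (intro equalityI subsetI)
      fix x assume "x \<in> ?S"
      then show "x \<in> {..<Suc (Max ?S)}" using fin Max_ge[of ?S x] by (simp add: less_Suc_eq_le)
    next
      fix x assume "x \<in> {..<Suc (Max ?S)}"
      then show "x \<in> ?S" using down[of "Max ?S" x] Max_in[OF fin False] by simp
    qed
    then show ?thesis by blast
  qed auto
  then obtain m where m: "?S = {..<m}" by blast
  then have "m = plen q" by (simp add: plen_def)
  with m show ?thesis by simp
qed

lemma finite_partitions: "finite {q. is_partition n q \<and> q 0 = k}"
proof (rule finite_subset)
  show "{q. is_partition n q \<and> q 0 = k} \<subseteq>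
      {q. \<forall>j. (j \<in> {..<n} \<longrightarrow> q j \<in> {..n}) \<and> (j \<notin> {..<n} \<longrightarrow> q j = 0)}"
  proof (intro subsetI CollectI allI conjI impI)
    fix q j assume "q \<in> {q. is_partition n q \<and> q 0 = k}"
    then have q: "is_partition n q" by simp
    then have fin: "finite {j. q j > 0}" and s: "(\<Sum>j | q j > 0. q j) = n"
      by (auto simp: is_partition_def)
    have le: "q j \<le> n"
    proof (cases "q j > 0")
      case True
      then show ?thesis using member_le_sum[of j "{j. q j > 0}" q] fin s by simp
    qed simp
    then show "q j \<in> {..n}" by simp
    have "plen q = (\<Sum>j | q j > 0. 1)" by (simp add: plen_def)
    also have "\<dots> \<le> (\<Sum>j | q j > 0. q j)" by (rule sum_mono) auto
    finally have len: "plen q \<le> n" using s by simp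
    assume "j \<notin> {..<n}"
    then have "j \<notin> {j. q j > 0}" using len plen_support[OF q] by auto
    then show "q j = 0" by simp
  qed
  show "finite {q :: nat \<Rightarrow> nat. \<forall>j. (j \<in> {..<n} \<longrightarrow> q j \<in> {..n}) \<and> (j \<notin> {..<n} \<longrightarrow> q j = 0)}"
    by (rule finite_set_of_finite_funs) auto
qed

lemma partitions_0: "{q. is_partition 0 q \<and> q 0 = 0} = {\<lambda>_. 0}"
proof (intro equalityI subsetI)
  fix q assume "q \<in> {q. is_partition 0 q \<and> q 0 = 0}"
  then have "antimono q" "q 0 = 0" by (auto simp: is_partition_def)
  then have "q j = 0" for j using antimonoD[of q 0 j] by simp
  then show "q \<in> {\<lambda>_. 0}" by auto
qed (auto simp: is_partition_def antimono_def)

lemma partitions_Suc_0: "{q. is_partition (Suc n) q \<and> q 0 = 0} = {}"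
proof -
  have False if "is_partition (Suc n) q" "q 0 = 0" for q
  proof -
    have "antimono q" using that by (simp add: is_partition_def)
    then have "q j = 0" for j using antimonoD[of q 0 j] that by simp
    then show False using that by (simp add: is_partition_def)
  qed
  then show ?thesis by blast
qed

text \<open>The boundary values follow from the formula, with no separate stipulation.\<close>

lemma ward_lah_0_0: "ward_lah 0 0 = 1"
  by (simp add: ward_lah_def partition_transform_def falling_fact_def partitions_0 plen_def)

lemma ward_lah_n_0: "n \<ge> 1 \<Longrightarrow> ward_lah n 0 = 0"
  by (cases n) (simp_all add: ward_lah_def partition_transform_def partitions_Suc_0)

lemma ward_lah_0_k: "k \<ge> 1 \<Longrightarrow> ward_lah 0 k = 0"
  by (simp add: ward_lah_def)

lemma ward_lah_gt: "k > n \<Longrightarrow> ward_lah n k = 0"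
  by (simp add: ward_lah_def)

end

theory Submission
  imports Defs
begin

text \<open>
  Removing the first part \<open>k\<close> of a partition of \<open>n\<close> leaves a partition of \<open>n - k\<close> with first part
  at most \<open>k\<close>, which gives a recursion for the partition transform. For the constant sequence
  \<open>1\<close> Vandermonde's identity solves the recursion by a binomial coefficient: up to sign, the
  transform counts the compositions of \<open>n\<close> into \<open>k\<close> parts. Hence
  \<open>W(n,k) = (n + k)! / k! * binom (n - 1) (k - 1)\<close>, and after multiplication by
  \<open>k! (k - 1)! (n - k)!\<close> the claimed recurrence becomes a polynomial identity.
\<close>

lemma support_case_nat:
  assumes "0 < k"
  shows "{j. 0 < (case_nat k r j :: nat)} = insert 0 (Suc ` {j. 0 < r j})"
proof (rule set_eqI)
  fix j
  show "j \<in> {j. 0 < (case_nat k r j :: nat)} \<longleftrightarrow> j \<in> insert 0 (Suc ` {j. 0 < r j})"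
    using assms by (cases j) auto
qed

lemma plen_case_nat:
  assumes "0 < k" "finite {j. 0 < r j}"
  shows "plen (case_nat k r) = Suc (plen r)"
  unfolding plen_def support_case_nat[OF assms(1)]
  using assms(2) by (subst card_insert_disjoint) (auto simp: card_image)

lemma antimono_case_nat_iff:
  "antimono (case_nat k r :: nat \<Rightarrow> nat) \<longleftrightarrow> r 0 \<le> k \<and> antimono r"
  by (auto simp: antimono_iff_le_Suc split: nat.splits)

lemma is_partition_case_nat_iff:
  assumes "0 < k"
  shows "is_partition (k + m) (case_nat k r) \<longleftrightarrow> r 0 \<le> k \<and> is_partition m r"
proof -
  have "(\<Sum>j\<in>insert 0 (Suc ` {j. 0 < r j}). case_nat k r j) = k + (\<Sum>j | 0 < r j. r j)"
    if "finite {j. 0 < r j}"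
    using that by (simp add: sum.reindex)
  moreover have "finite (insert 0 (Suc ` {j. 0 < r j})) \<longleftrightarrow> finite {j. 0 < r j}"
    by (simp add: finite_image_iff)
  ultimately show ?thesis
    unfolding is_partition_def support_case_nat[OF assms] antimono_case_nat_iff by auto
qed

text \<open>\<open>case_nat k r\<close> prepends \<open>k\<close> to \<open>r\<close>, so shifting
  inverts it. Splitting by the value \<open>j\<close> of \<open>r 0\<close> yields the index sets of
  the transforms of \<open>m\<close>.\<close>

lemma partitions_first_part:
  assumes "0 < k"
  shows "{q. is_partition (k + m) q \<and> q 0 = k} =
    case_nat k ` (\<Union>j\<in>{..k}. {r. is_partition m r \<and> r 0 = j})"
proof (intro equalityI subsetI)
  fix q assume q: "q \<in> {q. is_partition (k + m) q \<and> q 0 = k}"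
  define r where "r = (\<lambda>j. q (Suc j))"
  have "q = case_nat k r"
    using q by (auto simp: r_def split: nat.splits)
  with q show "q \<in> case_nat k ` (\<Union>j\<in>{..k}. {r. is_partition m r \<and> r 0 = j})"
    by (auto simp: is_partition_case_nat_iff[OF assms])
qed (auto simp: is_partition_case_nat_iff[OF assms])

text \<open>The factor at index 0 is \<open>(k choose r 0) * a 1 ^ k\<close>; the other factors are
  those of the tail \<open>r\<close> for the shifted sequence. The sign \<open>(- 1) ^ j\<close>
  cancels the one built into the transform of \<open>m\<close>.\<close>

lemma partition_transform_rec:
  fixes a :: "nat \<Rightarrow> 'a::comm_ring_1"
  assumes "0 < k"
  shows "partition_transform (k + m) k a = (- 1) ^ k * a 1 ^ k *
    (\<Sum>j\<le>k. (- 1) ^ j * of_nat (k choose j) * partition_transform m j (\<lambda>i. a (Suc i)))"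
proof -
  define R where "R j = {r. is_partition m r \<and> r 0 = j}" for j
  define w where "w b q = (\<Prod>j<plen q. of_nat (q j choose q (j + 1)) * b (j + 1) ^ q j)"
    for b :: "nat \<Rightarrow> 'a" and q
  have inj: "inj_on (case_nat k) A" for A :: "(nat \<Rightarrow> nat) set"
  proof (rule inj_onI)
    fix r s :: "nat \<Rightarrow> nat" assume eq: "case_nat k r = case_nat k s"
    have "r j = s j" for j using fun_cong[OF eq, of "Suc j"] by simp
    then show "r = s" by auto
  qed
  have w_rec: "w a (case_nat k r) = of_nat (k choose j) * a 1 ^ k * w (\<lambda>i. a (Suc i)) r"
    if "r \<in> R j" for r j
  proof -
    have "finite {j. 0 < r j}" "r 0 = j"
      using that by (auto simp: R_def is_partition_def)
    then show ?thesis
      by (simp add: w_def plen_case_nat assms prod.lessThan_Suc_shift del: prod.lessThan_Suc)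
  qed
  have transform: "partition_transform n j b = (- 1) ^ j * (\<Sum>q | is_partition n q \<and> q 0 = j. w b q)"
    for n j and b :: "nat \<Rightarrow> 'a"
    unfolding partition_transform_def w_def sum_distrib_left by (rule sum.cong) auto
  have "(\<Sum>q | is_partition (k + m) q \<and> q 0 = k. w a q) =
      (\<Sum>r\<in>(\<Union>j\<in>{..k}. R j). w a (case_nat k r))"
    unfolding partitions_first_part[OF assms] R_def[symmetric]
    by (subst sum.reindex[OF inj]) simp
  also have "\<dots> = (\<Sum>j\<le>k. \<Sum>r\<in>R j. w a (case_nat k r))"
    by (rule sum.UNION_disjoint) (auto simp: R_def finite_partitions)
  also have "\<dots> = a 1 ^ k * (\<Sum>j\<le>k. of_nat (k choose j) * (\<Sum>r\<in>R j. w (\<lambda>i. a (Suc i)) r))"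
    by (simp add: w_rec sum_distrib_left mult_ac)
  finally have "partition_transform (k + m) k a = (- 1) ^ k * a 1 ^ k *
      (\<Sum>j\<le>k. of_nat (k choose j) * (\<Sum>r\<in>R j. w (\<lambda>i. a (Suc i)) r))"
    by (simp only: transform mult.assoc)
  moreover have "(\<Sum>r\<in>R j. w b r) = (- 1) ^ j * partition_transform m j b" for j b
    unfolding transform R_def by (simp flip: mult.assoc power_mult_distrib)
  ultimately show ?thesis
    by (simp only: mult_ac)
qed

lemma partition_transform_first_part_0:
  "partition_transform n 0 a = (if n = 0 then 1 else 0)"
  by (cases n) (simp_all add: partition_transform_def partitions_0 partitions_Suc_0 plen_def)

lemma partition_transform_first_part_gt:
  assumes "n < k"
  shows "partition_transform n k a = 0"
proof -
  have "q 0 \<le> n" if "is_partition n q" for q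
  proof (cases "q 0 = 0")
    case False
    then have "q 0 \<le> (\<Sum>j | 0 < q j. q j)"
      using that by (intro member_le_sum) (auto simp: is_partition_def)
    then show ?thesis
      using that by (simp add: is_partition_def)
  qed simp
  then have "{q. is_partition n q \<and> q 0 = k} = {}"
    using assms by fastforce
  then show ?thesis
    unfolding partition_transform_def by (simp only: sum.empty)
qed

text \<open>With truncated subtraction the binomial is \<open>1\<close> for \<open>n = k = 0\<close> and \<open>0\<close> for \<open>n > k = 0\<close>,
  which \<open>binom (n - 1) (k - 1)\<close> would not be.\<close>

lemma partition_transform_one:
  assumes "k \<le> n"
  shows "partition_transform n k (\<lambda>_. 1) = (- 1) ^ k * int ((n - 1) choose (n - k))"
  using assms
proof (induction n arbitrary: k rule: less_induct)
  case (less n)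
  show ?case
  proof (cases "k = 0")
    case True
    then show ?thesis
      by (simp add: partition_transform_first_part_0 binomial_eq_0)
  next
    case False
    define m where "m = n - k"
    have n: "n = k + m" "m < n"
      using less.prems False by (auto simp: m_def)
    \<comment> \<open>The induction hypothesis covers only \<open>j \<le> m\<close>; beyond that the
      transform vanishes. Its sign cancels the explicit one.\<close>
    have vandermonde_term: "(- 1) ^ j * int (k choose j) * partition_transform m j (\<lambda>_. 1) =
        (if j \<le> m then int ((k choose j) * ((m - 1) choose (m - j))) else 0)" for j
    proof (cases "j \<le> m")
      case True
      have "(- 1) ^ j * ((- 1) ^ j :: int) = 1"
        by (simp flip: power_mult_distrib)
      with True show ?thesis
        using less.IH[OF n(2) True] by simp
    qed (simp add: partition_transform_first_part_gt)
    have "(\<Sum>j\<le>k. (- 1) ^ j * int (k choose j) * partition_transform m j (\<lambda>_. 1)) =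
        (\<Sum>j\<in>{j\<in>{..k}. j \<le> m}. int ((k choose j) * ((m - 1) choose (m - j))))"
      unfolding vandermonde_term by (simp only: sum.inter_filter[symmetric] finite_atMost)
    \<comment> \<open>Indices \<open>j > k\<close> may be added because \<open>k choose j\<close> is
      0 there.\<close>
    also have "\<dots> = (\<Sum>j\<le>m. int ((k choose j) * ((m - 1) choose (m - j))))"
      by (rule sum.mono_neutral_left) (auto simp: binomial_eq_0)
    also have "\<dots> = int ((k + (m - 1)) choose m)"
      by (simp only: vandermonde flip: of_nat_sum)
    \<comment> \<open>For \<open>m = 0\<close> the upper entries differ by truncation, but both
      binomials have lower entry 0 and equal 1.\<close>
    also have "(k + (m - 1)) choose m = (n - 1) choose (n - k)"
      using False by (cases m) (auto simp: n)
    finally show ?thesis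
      using partition_transform_rec[of k m "\<lambda>_. 1 :: int"] False by (simp add: n)
  qed
qed

text \<open>Splitting off the largest factor lowers \<open>n\<close> by one while \<open>k\<close>
  stays fixed. The product form avoids division in the integers.\<close>

lemma fact_mult_falling_fact:
  "fact k * falling_fact (int (n + k)) n = fact (n + k)"
proof (induction n)
  case (Suc n)
  have "falling_fact (int (Suc n + k)) (Suc n) = int (Suc n + k) * falling_fact (int (n + k)) n"
    unfolding falling_fact_def prod.lessThan_Suc_shift by (simp add: algebra_simps)
  then have "fact k * falling_fact (int (Suc n + k)) (Suc n) =
      int (Suc n + k) * (fact k * falling_fact (int (n + k)) n)"
    by (simp only: mult_ac)
  also have "\<dots> = fact (Suc n + k)"
    unfolding Suc by simp
  finally show ?case .
qed (simp add: falling_fact_def)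

text \<open>The two signs \<open>(- 1) ^ k\<close> cancel, and \<open>n - k\<close> and
  \<open>k - 1\<close> add up to \<open>n - 1\<close>, so the factorials clear the denominators of
  the binomial.\<close>

lemma ward_lah_fact:
  assumes "1 \<le> k" "k \<le> n"
  shows "fact k * fact (k - 1) * fact (n - k) * ward_lah n k = fact (n + k) * fact (n - 1)"
proof -
  have "(- 1) ^ k * ((- 1) ^ k :: int) = 1"
    by (simp flip: power_mult_distrib)
  then have "ward_lah n k = falling_fact (int (n + k)) n * int ((n - 1) choose (n - k))"
    using assms by (simp add: ward_lah_def partition_transform_one)
  moreover have "fact (n - k) * fact (k - 1) * int ((n - 1) choose (n - k)) = fact (n - 1)"
  proof -
    have "fact (n - k) * fact (k - 1) * ((n - 1) choose (n - k)) = fact (n - 1)"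
      using binomial_fact_lemma[of "n - k" "n - 1"] assms by simp
    from arg_cong[OF this, of int] show ?thesis
      by simp
  qed
  ultimately show ?thesis
    unfolding fact_mult_falling_fact[of k n, symmetric] by (simp only: mult_ac)
qed

theorem theorem2p10:
  fixes n k :: nat
  assumes "n \<ge> 2" and "k \<ge> 1"
  shows "ward_lah n k =
           2 * (2 * int n - 1) * ward_lah (n - 1) (k - 1)
           - int n * (int n - 2) * ward_lah (n - 2) k
           - (- 2 * int n + 1) * ward_lah (n - 1) k"
proof (cases "k \<le> n")
  case False
  then show ?thesis
    using assms by (simp add: ward_lah_gt)
next
  case True
  obtain j where k: "k = Suc j"
    using assms by (cases k) auto
  obtain d where d: "n = Suc j + d"
    using True k le_Suc_ex by blast
  \<comment> \<open>\<open>M\<close> is \<open>k! (k - 1)! (n - k)!\<close>, which clears all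
    denominators. Each of the four terms then becomes a polynomial times \<open>A * B\<close>, that
    is \<open>(n + k - 2)! (n - 2)!\<close>.\<close>
  define M :: int where "M = fact (Suc j) * fact j * fact d"
  define A :: int where "A = fact (n + j - 1)"
  define B :: int where "B = fact (n - 2)"
  obtain m where m: "n = Suc (Suc m)"
    using assms(1) by (metis add_2_eq_Suc le_Suc_ex)
  have A: "fact (n + j) = (int n + int j) * A"
    by (simp add: A_def m)
  have B: "fact (n - 1) = (int n - 1) * B"
    by (simp add: B_def m)
  have W: "M * ward_lah n k = (int n + int k) * ((int n + int j) * A) * ((int n - 1) * B)"
  proof -
    have "fact (n + k) = (int n + int k) * fact (n + j)"
      by (simp add: k)
    then show ?thesis
      using ward_lah_fact[of k n] unfolding M_def A[symmetric] B[symmetric] by (simp add: k d)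
  qed
  \<comment> \<open>For \<open>j = 0\<close> both sides vanish, since \<open>n - 1 \<ge> 1\<close>
    and \<open>k - 1 = 0\<close>.\<close>
  have W11: "M * ward_lah (n - 1) (k - 1) = int k * int j * (A * B)"
  proof (cases j)
    case 0
    then show ?thesis
      using assms by (simp add: k ward_lah_n_0)
  next
    case (Suc i)
    have "M = int k * int j * (fact (Suc i) * fact i * fact d)"
      by (simp add: M_def k Suc)
    moreover have "fact (Suc i) * fact i * fact d * ward_lah (n - 1) (k - 1) = A * B"
      using ward_lah_fact[of j "n - 1"] by (simp add: A_def B_def k d Suc del: fact_Suc)
    ultimately show ?thesis
      by (simp only: mult.assoc)
  qed
  have W10: "M * ward_lah (n - 1) k = int d * ((int n + int j) * A * B)"
  proof (cases d)
    case 0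
    then show ?thesis
      by (simp add: k d ward_lah_gt)
  next
    case (Suc e)
    have "M = int d * (fact (Suc j) * fact j * fact e)"
      by (simp add: M_def Suc)
    moreover have "fact (Suc j) * fact j * fact e * ward_lah (n - 1) k = fact (n + j) * B"
      using ward_lah_fact[of k "n - 1"] by (simp add: B_def k d Suc del: fact_Suc)
    ultimately show ?thesis
      by (simp only: mult.assoc A)
  qed
  \<comment> \<open>The coefficient \<open>n - 2\<close> stays with this term because it turns
    \<open>(n - 3)!\<close> into \<open>B\<close>. For \<open>d \<le> 1\<close> one has
    \<open>k > n - 2\<close>, and both sides are 0.\<close>
  have W20: "M * ((int n - 2) * ward_lah (n - 2) k) = int d * (int d - 1) * (A * B)"
  proof (cases "d \<le> 1")
    case True
    then have "d = 0 \<or> d = 1"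
      by auto
    then show ?thesis
      using m by (auto simp: k d ward_lah_gt)
  next
    case False
    then obtain e where e: "d = Suc (Suc e)"
      by (metis One_nat_def not_less_eq_eq Suc_le_D)
    have "M = int d * (int d - 1) * (fact (Suc j) * fact j * fact e)"
      by (simp add: M_def e)
    moreover have "fact (Suc j) * fact j * fact e * ward_lah (n - 2) k = A * fact (j + e)"
      using ward_lah_fact[of k "n - 2"] by (simp add: A_def k d e del: fact_Suc)
    moreover have "B = (int n - 2) * fact (j + e)"
      by (simp add: B_def d e)
    ultimately show ?thesis
      by (simp add: mult_ac)
  qed
  have jd: "int j = int k - 1" "int d = int n - int k"
    by (simp_all add: k d)
  \<comment> \<open>In terms of \<open>n\<close> and \<open>k\<close> alone, both sides are
    \<open>A * B\<close> times the same polynomial. Afterwards \<open>M\<close>, a product of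
    factorials and hence nonzero, is cancelled.\<close>
  have "M * ward_lah n k =
      2 * (2 * int n - 1) * (M * ward_lah (n - 1) (k - 1))
      - int n * (M * ((int n - 2) * ward_lah (n - 2) k))
      - (- 2 * int n + 1) * (M * ward_lah (n - 1) k)"
    unfolding W W11 W10 W20 jd by (simp only: algebra_simps)
  also have "\<dots> = M * (2 * (2 * int n - 1) * ward_lah (n - 1) (k - 1)
      - int n * (int n - 2) * ward_lah (n - 2) k - (- 2 * int n + 1) * ward_lah (n - 1) k)"
    by (simp add: algebra_simps)
  finally show ?thesis
    by (simp add: M_def)
qed

end
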